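(* Let $k\ge 1$ be an integer and let $f(z)=z+\sum_{n=1}^\infty a_{nk+1} z^{nk+1}$ be a function in $\mathcal{S}^*$ (the class of normalized starlike univalent functions on the open unit disk $\mathbb{U}$). Then $$ \left\vert 1 - a_{2k+1}^2 - 2a_{k+1}^2 + 2a_{k+1}^2 a_{2k+1} \right\vert \leq \begin{cases} 1+\dfrac{8}{k^2}+\dfrac{(k+2)(6-k)}{k^4}, & 1\leq k\leq 3,\\[2mm] 1+\dfrac{8}{k^2}+\dfrac{2+k}{k^3}, & k\geq 3. \end{cases} $$ The estimate is sharp for $k=1,2,3$: for each $k\in\{1,2,3\}$ there is a function $f\in\mathcal{S}^*$ of the form $f(z)=z+\sum_{n=1}^\infty a_{nk+1} z^{nk+1}$ for which equality holds.
   Context: $\mathbb{U}=\{z\in\mathbb{C}:|z|<1\}$. $\mathcal{S}$ is the class of analytic univalent functions $f$ on $\mathbb{U}$ with expansion $f(z)=z+\sum_{n=2}^\infty a_n z^n$ (i.e. $f(0)=0$, $f'(0)=1$). $\mathcal{S}^*$ is the subclass of starlike functions: $f\in\mathcal{S}$ belongs to $\mathcal{S}^*$ if and only if $\operatorname{Re}\left(\frac{z f'(z)}{f(z)}\right)>0$ for all $z\in\mathbb{U}$ (the quotient being understood as $1$ at $z=0$). *)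

theory Defs
  imports "HOL-Complex_Analysis.Complex_Analysis"
begin

(* Functions on the unit disk are total functions complex => complex;
   their values outside ball 0 1 play no role. *)

definition class_S :: "(complex \<Rightarrow> complex) set" where
  "class_S = {f. f holomorphic_on ball 0 1 \<and> inj_on f (ball 0 1) \<and> f 0 = 0 \<and> deriv f 0 = 1}"

(* The case z = 0 fills in the removable singularity of z f'(z) / f(z). *)
definition class_S_star :: "(complex \<Rightarrow> complex) set" where
  "class_S_star = {f \<in> class_S.
     \<forall>z \<in> ball 0 1. Re (if z = 0 then 1 else z * deriv f z / f z) > 0}"

(* f(z) = z + sum_{n >= 1} a_{nk+1} z^(nk+1) on the unit disk; only the values of a at the
   indices nk+1 with n >= 1 matter. The shift by Suc makes the series start at n = 1. *)
definition has_gap_expansion :: "nat \<Rightarrow> (complex \<Rightarrow> complex) \<Rightarrow> (nat \<Rightarrow> complex) \<Rightarrow> bool" where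
  "has_gap_expansion k f a \<longleftrightarrow>
     (\<forall>z \<in> ball 0 1. (\<lambda>n. a (Suc n * k + 1) * z ^ (Suc n * k + 1)) sums (f z - z))"

end

theory Submission
  imports Defs
begin

text \<open>Write \<open>f(z) = z g(z^k)\<close>. Then \<open>z f'(z) / f(z) = 1 + k w g'(w) / g(w)\<close> with \<open>w = z^k\<close>, and the
  Cayley transform of this function of positive real part is \<open>w \<psi>(w)\<close> with
  \<open>\<psi> = k g' / (2 g + k w g')\<close> and \<open>|\<psi>| \<le> 1\<close>. With \<open>A = a_{k+1}\<close> and \<open>B = a_{2k+1}\<close>, the Schwarz-Pick
  inequality \<open>|\<psi>'(0)| \<le> 1 - |\<psi>(0)|^2\<close> reads \<open>|k B - k (k + 2) A^2 / 4| \<le> 1 - k^2 |A|^2 / 4\<close>. It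
  bounds \<open>|A|\<close>, \<open>|B|\<close> and the Fekete-Szego functional \<open>|B - 2 A^2|\<close>, and the quantity in question is
  \<open>1 - 2 A^2 - B (B - 2 A^2)\<close>. Equality holds for \<open>z (1 - i z^k)^(-2/k)\<close>, which is univalent because
  its \<open>k\<close>-th power is a rotated Koebe function of \<open>z^k\<close>.\<close>

section \<open>Consequences of the Schwarz lemma\<close>

text \<open>Composing \<open>\<psi>\<close> with the disk automorphism that sends
  \<open>\<psi> 0\<close> to 0 gives a map to which the Schwarz lemma applies; its derivative at 0
  is \<open>deriv \<psi> 0\<close> divided by \<open>1 - (cmod (\<psi> 0))^2\<close>. The bound on
  \<open>\<psi>\<close> is not strict, so the case where modulus 1 is attained is split off: there
  \<open>\<psi>\<close> is constant by the maximum principle.\<close>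

lemma Schwarz_Pick_deriv_0:
  fixes \<psi> :: "complex \<Rightarrow> complex"
  assumes hol: "\<psi> holomorphic_on ball 0 1"
    and le1: "\<And>z. cmod z < 1 \<Longrightarrow> cmod (\<psi> z) \<le> 1"
  shows "cmod (deriv \<psi> 0) \<le> 1 - (cmod (\<psi> 0))\<^sup>2"
proof (cases "\<exists>z. cmod z < 1 \<and> cmod (\<psi> z) = 1")
  case True
  then obtain z where z: "cmod z < 1" "cmod (\<psi> z) = 1"
    by blast
  have "\<psi> constant_on ball 0 1"
    by (rule maximum_modulus_principle[OF hol, of "ball 0 1" z]) (use z le1 in auto)
  then obtain c where c: "\<And>w. w \<in> ball 0 1 \<Longrightarrow> \<psi> w = c"
    by (auto simp: constant_on_def)
  have "(\<psi> has_field_derivative 0) (at 0)"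
    by (rule has_field_derivative_transform_within_open[where S = "ball 0 1" and f = "\<lambda>_. c"])
       (auto simp: c)
  then have "deriv \<psi> 0 = 0"
    by (rule DERIV_imp_deriv)
  moreover have "cmod (\<psi> 0) = 1"
    using c[of 0] c[of z] z by simp
  ultimately show ?thesis
    by simp
next
  case False
  then have lt1: "cmod (\<psi> z) < 1" if "cmod z < 1" for z
    using le1 that by force
  define c where "c = \<psi> 0"
  have c: "cmod c < 1"
    using lt1[of 0] by (simp add: c_def)
  define h where "h = Moebius_function 0 c \<circ> \<psi>"
  have "h holomorphic_on ball 0 1"
    unfolding h_def
    by (rule holomorphic_on_compose_gen[OF hol Moebius_function_holomorphic[OF c]])
       (auto simp: lt1)
  moreover have "h 0 = 0"
    by (simp add: h_def c_def Moebius_function_eq_zero)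
  moreover have "cmod (h z) < 1" if "cmod z < 1" for z
    using Moebius_function_norm_lt_1[OF c lt1[OF that]] by (simp add: h_def)
  ultimately have "cmod (deriv h 0) \<le> 1"
    by (intro Schwarz_Lemma(2)[of h 0]) auto
  have pos: "0 < 1 - (cmod c)\<^sup>2"
    using c by (simp add: power_less_one_iff abs_square_less_1)
  \<comment> \<open>This is the denominator of the Moebius map at \<open>c\<close>; being a positive
    real, it passes unchanged through the norm.\<close>
  have nz: "1 - cnj c * c = of_real (1 - (cmod c)\<^sup>2)"
    by (metis complex_norm_square mult.commute of_real_1 of_real_diff)
  have nz0: "1 - cnj c * c \<noteq> 0"
    unfolding nz using pos by (metis less_irrefl of_real_eq_0_iff)
  have "(\<psi> has_field_derivative deriv \<psi> 0) (at 0)"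
    by (rule holomorphic_derivI[OF hol]) auto
  then have "((\<lambda>z. (\<psi> z - c) / (1 - cnj c * \<psi> z)) has_field_derivative
      deriv \<psi> 0 / (1 - cnj c * c)) (at 0)"
    using nz0 by (auto intro!: derivative_eq_intros simp: c_def[symmetric])
  then have "deriv h 0 = deriv \<psi> 0 / (1 - cnj c * c)"
    by (intro DERIV_imp_deriv) (simp add: h_def o_def Moebius_function_simple)
  then have "cmod (deriv h 0) = cmod (deriv \<psi> 0) / (1 - (cmod c)\<^sup>2)"
    using pos unfolding nz by (simp add: norm_divide del: of_real_diff)
  with \<open>cmod (deriv h 0) \<le> 1\<close> pos show ?thesis
    by (simp add: c_def divide_le_eq)
qed

text \<open>Away from 0 the Schwarz inequality for \<open>z * \<psi> z\<close> is divided by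
  \<open>cmod z\<close>; at 0 the value \<open>\<psi> 0\<close> is the derivative of that
  product.\<close>

lemma Schwarz_quotient_bound:
  fixes \<psi> :: "complex \<Rightarrow> complex"
  assumes hol: "\<psi> holomorphic_on ball 0 1"
    and lt1: "\<And>z. cmod z < 1 \<Longrightarrow> cmod (z * \<psi> z) < 1"
    and z: "cmod z < 1"
  shows "cmod (\<psi> z) \<le> 1"
proof -
  have hol': "(\<lambda>z. z * \<psi> z) holomorphic_on ball 0 1"
    by (intro holomorphic_intros hol)
  have "(\<psi> has_field_derivative deriv \<psi> 0) (at 0)"
    by (rule holomorphic_derivI[OF hol]) auto
  then have "((\<lambda>z. z * \<psi> z) has_field_derivative \<psi> 0) (at 0)"
    by (auto intro!: derivative_eq_intros)
  then have "deriv (\<lambda>z. z * \<psi> z) 0 = \<psi> 0"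
    by (rule DERIV_imp_deriv)
  then have "cmod (\<psi> 0) \<le> 1"
    using Schwarz_Lemma(2)[OF hol' _ lt1 z] by simp
  moreover have "cmod (z * \<psi> z) \<le> cmod z"
    using Schwarz_Lemma(1)[OF hol' _ lt1 z] by simp
  ultimately show ?thesis
    by (cases "z = 0") (auto simp: norm_mult)
qed

section \<open>Coefficient inequality for starlike functions with gaps\<close>

text \<open>With \<open>p = 1 + q\<close> the quotient is the Cayley transform
  \<open>(p - 1) / (p + 1)\<close>. The squared moduli of \<open>q + 2\<close> and \<open>q\<close>
  differ by \<open>4 * Re (1 + q)\<close>.\<close>

lemma cmod_div_add_2_less_1:
  assumes "0 < Re (1 + q)"
  shows "cmod (q / (q + 2)) < 1"
proof -
  have "(cmod q)\<^sup>2 < (cmod (q + 2))\<^sup>2"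
    unfolding cmod_power2 using assms by (simp add: power2_eq_square algebra_simps)
  then have "cmod q < cmod (q + 2)"
    by (rule power2_less_imp_less) simp
  then show ?thesis
    by (simp add: norm_divide divide_less_eq)
qed

lemma powser_has_field_derivative_disk:
  fixes c :: "nat \<Rightarrow> complex"
  assumes "\<And>w. cmod w < 1 \<Longrightarrow> summable (\<lambda>n. c n * w ^ n)" and "cmod w < 1"
  shows "((\<lambda>w. \<Sum>n. c n * w ^ n) has_field_derivative (\<Sum>n. diffs c n * w ^ n)) (at w)"
  using termdiffs_strong'[of 1 c w] assms by blast

lemma starlike_coeff_bound:
  fixes c :: "nat \<Rightarrow> complex" and g g' :: "complex \<Rightarrow> complex" and \<kappa> :: real
  defines "g \<equiv> \<lambda>w. \<Sum>n. c n * w ^ n" and "g' \<equiv> \<lambda>w. \<Sum>n. diffs c n * w ^ n"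
  assumes summ: "\<And>w. cmod w < 1 \<Longrightarrow> summable (\<lambda>n. c n * w ^ n)"
    and c0: "c 0 = 1"
    and nz: "\<And>w. cmod w < 1 \<Longrightarrow> g w \<noteq> 0"
    and Re: "\<And>w :: complex. cmod w < 1 \<Longrightarrow> 0 < Re (1 + \<kappa> * w * g' w / g w)"
  shows "cmod (\<kappa> * c 2 - \<kappa> * (\<kappa> + 2) / 4 * (c 1)\<^sup>2) \<le> 1 - \<kappa>\<^sup>2 / 4 * (cmod (c 1))\<^sup>2"
proof -
  have summ': "summable (\<lambda>n. diffs c n * w ^ n)" if "cmod w < 1" for w
    by (rule termdiff_converges[OF that summ])
  have dg: "(g has_field_derivative g' w) (at w)" if "cmod w < 1" for w
    unfolding g_def g'_def by (rule powser_has_field_derivative_disk[OF summ that])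
  have dg': "(g' has_field_derivative (\<Sum>n. diffs (diffs c) n * w ^ n)) (at w)"
    if "cmod w < 1" for w
    unfolding g'_def by (rule powser_has_field_derivative_disk[OF summ' that])
  have g0: "g 0 = 1" and g'0: "g' 0 = c 1"
    and g''0: "diffs (diffs c) 0 = 2 * c 2"
    by (simp_all add: g_def g'_def c0 diffs_def numeral_2_eq_2)
  define D where "D w = 2 * g w + \<kappa> * w * g' w" for w :: complex
  define \<psi> where "\<psi> w = \<kappa> * g' w / D w" for w :: complex
  have D: "D w = g w * (\<kappa> * w * g' w / g w + 2)" if "cmod w < 1" for w :: complex
    using nz[OF that] by (simp add: D_def field_simps)
  have Dnz: "D w \<noteq> 0" if "cmod w < 1" for w
  proof
    assume "D w = 0"
    then have "\<kappa> * w * g' w / g w = - 2"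
      using D[OF that] nz[OF that] by (simp add: eq_neg_iff_add_eq_0)
    then show False
      using Re[OF that] by simp
  qed
  have hol: "g holomorphic_on ball 0 1" "g' holomorphic_on ball 0 1"
    using dg dg' by (auto simp: holomorphic_on_open) blast+
  have hol\<psi>: "\<psi> holomorphic_on ball 0 1"
    unfolding \<psi>_def D_def
    by (intro holomorphic_intros hol) (use Dnz in \<open>auto simp: D_def\<close>)
  have lt1: "cmod (w * \<psi> w) < 1" if "cmod w < 1" for w
  proof -
    define q where "q = \<kappa> * w * g' w / g w"
    have "w * \<psi> w = q / (q + 2)"
      using nz[OF that] Dnz[OF that] by (simp add: \<psi>_def D[OF that] q_def)
    then show ?thesis
      using cmod_div_add_2_less_1[of q] Re[OF that] by (simp add: q_def)
  qed
  have le1: "cmod (\<psi> w) \<le> 1" if "cmod w < 1" for w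
    using Schwarz_quotient_bound[OF hol\<psi> lt1 that] .
  have \<psi>0: "\<psi> 0 = \<kappa> / 2 * c 1"
    by (simp add: \<psi>_def D_def g0 g'0)
  \<comment> \<open>Quotient rule with \<open>D 0 = 2\<close>,
    \<open>D'(0) = (\<kappa> + 2) * c 1\<close> and \<open>g''(0) = 2 * c 2\<close>.\<close>
  have "(\<psi> has_field_derivative \<kappa> * c 2 - \<kappa> * (\<kappa> + 2) / 4 * (c 1)\<^sup>2) (at 0)"
    unfolding \<psi>_def D_def
    by (rule derivative_eq_intros refl dg dg' | simp add: g0 g'0 g''0)+
       (simp add: g0 g'0 field_simps power2_eq_square)
  then have "deriv \<psi> 0 = \<kappa> * c 2 - \<kappa> * (\<kappa> + 2) / 4 * (c 1)\<^sup>2"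
    by (rule DERIV_imp_deriv)
  with Schwarz_Pick_deriv_0[OF hol\<psi> le1] show ?thesis
    by (simp add: \<psi>0 norm_mult norm_divide power_mult_distrib power_divide)
qed

text \<open>Dividing the gap series by \<open>z\<close> leaves a power series in
  \<open>z ^ k\<close>. Its constant term is set to 1 by hand, since the gap expansion starts at
  index \<open>k + 1\<close> and does not determine \<open>a 1\<close>. Convergence at
  \<open>w\<close> comes from a \<open>k\<close>-th root of \<open>w\<close>.\<close>

lemma gap_expansion_factor:
  assumes k: "k \<ge> 1" and f: "f \<in> class_S_star" and gap: "has_gap_expansion k f a"
  defines "c \<equiv> \<lambda>n. if n = 0 then 1 else a (n * k + 1)"
  shows "cmod w < 1 \<Longrightarrow> summable (\<lambda>n. c n * w ^ n)"
    and "cmod z < 1 \<Longrightarrow> f z = z * (\<Sum>n. c n * (z ^ k) ^ n)"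
proof -
  have sums: "(\<lambda>n. c n * (z ^ k) ^ n) sums (f z / z)" if "cmod z < 1" "z \<noteq> 0" for z
  proof -
    have "(\<lambda>n. a (Suc n * k + 1) * z ^ (Suc n * k + 1)) sums (f z - z)"
      using gap that by (auto simp: has_gap_expansion_def)
    then have "(\<lambda>n. a (Suc n * k + 1) * z ^ (Suc n * k + 1) / z) sums ((f z - z) / z)"
      by (rule sums_divide)
    moreover have "a (Suc n * k + 1) * z ^ (Suc n * k + 1) / z = c (Suc n) * (z ^ k) ^ Suc n" for n
      using that by (simp add: c_def power_add power_mult[symmetric] algebra_simps)
    \<comment> \<open>The subtracted \<open>z\<close> becomes the missing term of index 0, so the
      shifted sum can be extended to start there.\<close>
    moreover have "(f z - z) / z = f z / z - c 0 * (z ^ k) ^ 0"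
      using that by (simp add: c_def field_simps)
    ultimately have "(\<lambda>n. c (Suc n) * (z ^ k) ^ Suc n) sums (f z / z - c 0 * (z ^ k) ^ 0)"
      by (simp only:)
    then show ?thesis
      by (simp only: sums_Suc_iff[of "\<lambda>n. c n * (z ^ k) ^ n"] diff_add_cancel)
  qed
  show "summable (\<lambda>n. c n * w ^ n)" if w: "cmod w < 1" for w
  proof (cases "w = 0")
    case False
    obtain z where z: "w = z ^ k"
      using exists_complex_root[of k w] k by auto
    have "cmod z < 1"
      using w k unfolding z by (simp add: norm_power power_less_one_iff)
    moreover have "z \<noteq> 0"
      using False k z by auto
    ultimately show ?thesis
      unfolding z using sums sums_summable by blast
  qed (use sums_summable[OF powser_sums_zero] in blast)
  show "f z = z * (\<Sum>n. c n * (z ^ k) ^ n)" if "cmod z < 1" for z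
    using f sums_unique[OF sums[OF that]]
    by (cases "z = 0") (auto simp: class_S_star_def class_S_def field_simps)
qed

text \<open>Every \<open>w\<close> in the disk is some \<open>z ^ k\<close>, so starlikeness of
  \<open>f\<close> at \<open>z\<close> becomes the half-plane condition on \<open>g\<close> at
  \<open>w\<close>, and \<open>starlike_coeff_bound\<close> applies with
  \<open>\<kappa> = k\<close>.\<close>

lemma starlike_gap_coeff_bound:
  assumes k: "k \<ge> 1" and f: "f \<in> class_S_star" and gap: "has_gap_expansion k f a"
  shows "cmod (k * a (2*k+1) - k * (k + 2) / 4 * (a (k+1))\<^sup>2) \<le> 1 - k\<^sup>2 / 4 * (cmod (a (k+1)))\<^sup>2"
proof -
  define c where "c n = (if n = 0 then 1 else a (n * k + 1))" for n
  define g where "g w = (\<Sum>n. c n * w ^ n)" for w :: complex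
  define g' where "g' w = (\<Sum>n. diffs c n * w ^ n)" for w :: complex
  have summ: "summable (\<lambda>n. c n * w ^ n)" if "cmod w < 1" for w
    unfolding c_def by (rule gap_expansion_factor(1)[OF k f gap that])
  have fg: "f z = z * g (z ^ k)" if "cmod z < 1" for z
    unfolding g_def c_def by (rule gap_expansion_factor(2)[OF k f gap that])
  have g0: "g 0 = 1"
    by (simp add: g_def c_def)
  have dg: "(g has_field_derivative g' w) (at w)" if "cmod w < 1" for w
    unfolding g_def g'_def by (rule powser_has_field_derivative_disk[OF summ that])
  have *: "g w \<noteq> 0 \<and> 0 < Re (1 + real k * w * g' w / g w)" if w: "cmod w < 1" for w :: complex
  proof (cases "w = 0")
    case False
    obtain z where z: "w = z ^ k"
      using exists_complex_root[of k w] k by auto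
    have z1: "cmod z < 1"
      using w k unfolding z by (simp add: norm_power power_less_one_iff)
    have z0: "z \<noteq> 0"
      using False k z by auto
    \<comment> \<open>Univalence makes 0 the only zero of \<open>f\<close>, hence \<open>g\<close>
      has no zero.\<close>
    have "inj_on f (ball 0 1)" "f 0 = 0"
      using f by (auto simp: class_S_star_def class_S_def)
    then have fz: "f z \<noteq> 0"
      using inj_onD[of f "ball 0 1" z 0] z1 z0 by auto
    then have gw: "g w \<noteq> 0"
      using fg[OF z1] z by auto
    have "((\<lambda>z. g (z ^ k)) has_field_derivative g' w * (k * z ^ (k - 1))) (at z)"
      by (rule DERIV_chain2[where f = g]) (use dg[OF w] z in \<open>auto intro!: derivative_eq_intros\<close>)
    then have "((\<lambda>z. z * g (z ^ k)) has_field_derivative g w + z * (g' w * (k * z ^ (k - 1)))) (at z)"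
      by (auto intro!: derivative_eq_intros simp: z)
    then have "(f has_field_derivative g w + z * (g' w * (k * z ^ (k - 1)))) (at z)"
      by (rule has_field_derivative_transform_within_open[where S = "ball 0 1"])
         (use fg z1 in auto)
    then have "deriv f z = g w + z * (g' w * (k * z ^ (k - 1)))"
      by (rule DERIV_imp_deriv)
    also have "\<dots> = g w + k * w * g' w"
      using k unfolding z by (cases k) auto
    finally have "z * deriv f z / f z = 1 + real k * w * g' w / g w"
      using fg[OF z1] gw z0 by (simp add: z[symmetric] field_simps)
    moreover have "0 < Re (if z = 0 then 1 else z * deriv f z / f z)"
      using f z1 unfolding class_S_star_def by auto
    ultimately show ?thesis
      using gw z0 by simp
  qed (simp add: g0)
  have "cmod (real k * c 2 - real k * (real k + 2) / 4 * (c 1)\<^sup>2)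
      \<le> 1 - (real k)\<^sup>2 / 4 * (cmod (c 1))\<^sup>2"
    by (rule starlike_coeff_bound)
       (use summ * in \<open>auto simp: g_def g'_def c_def[of 0]\<close>)
  then show ?thesis
    by (simp add: c_def)
qed

section \<open>From the coefficient inequality to the determinant\<close>

lemma convex_comb_le_max:
  fixes x y t :: real
  assumes "0 \<le> t" "t \<le> 1"
  shows "x * t + y * (1 - t) \<le> max x y"
  using convex_bound_le[of x "max x y" y t "1 - t"] assms by (simp add: mult.commute)

lemma det_bound_of_coeff_bound:
  fixes A B :: complex and \<kappa> :: real
  assumes \<kappa>: "\<kappa> \<ge> 1"
    and bd: "cmod (\<kappa> * B - \<kappa> * (\<kappa> + 2) / 4 * A\<^sup>2) \<le> 1 - \<kappa>\<^sup>2 / 4 * (cmod A)\<^sup>2"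
  shows "cmod (1 - B\<^sup>2 - 2 * A\<^sup>2 + 2 * A\<^sup>2 * B)
      \<le> 1 + 8 / \<kappa>\<^sup>2 + (\<kappa> + 2) * max \<bar>6 - \<kappa>\<bar> \<kappa> / \<kappa> ^ 4"
proof -
  define t where "t = \<kappa>\<^sup>2 / 4 * (cmod A)\<^sup>2"
  define R where "R = \<kappa> * B - \<kappa> * (\<kappa> + 2) / 4 * A\<^sup>2"
  have t: "0 \<le> t" "t \<le> 1"
    using order_trans[OF norm_ge_zero bd] unfolding t_def by simp_all
  have R: "cmod R \<le> 1 - t"
    using bd by (simp add: R_def t_def)
  \<comment> \<open>A Fekete-Szego estimate with parameter \<open>s\<close>: the two summands have
    norms at most \<open>\<kappa> * (1 - t)\<close> and
    \<open>\<bar>\<kappa> + 2 - 4 * s\<bar> * t\<close>, a convex combination. The values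
    \<open>s = 0\<close> and \<open>s = 2\<close> bound the two factors of the product
    below.\<close>
  have key: "\<kappa>\<^sup>2 * cmod (B - s * A\<^sup>2) \<le> max \<bar>\<kappa> + 2 - 4 * s\<bar> \<kappa>" for s :: real
  proof -
    have "\<kappa>\<^sup>2 * (B - s * A\<^sup>2) = \<kappa> * R + (\<kappa> + 2 - 4 * s) * (\<kappa>\<^sup>2 / 4 * A\<^sup>2)"
      by (simp add: R_def field_simps power2_eq_square)
    then have "cmod (\<kappa>\<^sup>2 * (B - s * A\<^sup>2)) \<le> cmod (\<kappa> * R) + cmod ((\<kappa> + 2 - 4 * s) * (\<kappa>\<^sup>2 / 4 * A\<^sup>2))"
      by (metis norm_triangle_ineq)
    also have "cmod ((\<kappa> + 2 - 4 * s) * (\<kappa>\<^sup>2 / 4 * A\<^sup>2)) = \<bar>\<kappa> + 2 - 4 * s\<bar> * t"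
      unfolding norm_mult norm_of_real norm_power t_def by simp
    also have "cmod (\<kappa> * R) \<le> \<kappa> * (1 - t)"
      using R \<kappa> by (simp add: norm_mult mult_left_mono)
    finally have "\<kappa>\<^sup>2 * cmod (B - s * A\<^sup>2) \<le> \<bar>\<kappa> + 2 - 4 * s\<bar> * t + \<kappa> * (1 - t)"
      by (simp add: norm_mult norm_power)
    also have "\<dots> \<le> max \<bar>\<kappa> + 2 - 4 * s\<bar> \<kappa>"
      using convex_comb_le_max[OF t] by simp
    finally show ?thesis .
  qed
  have B: "\<kappa>\<^sup>2 * cmod B \<le> \<kappa> + 2"
    using key[of 0] \<kappa> by simp
  have B2: "\<kappa>\<^sup>2 * cmod (B - 2 * A\<^sup>2) \<le> max \<bar>6 - \<kappa>\<bar> \<kappa>"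
    using key[of 2] by (simp add: abs_minus_commute)
  have "(\<kappa>\<^sup>2 * cmod B) * (\<kappa>\<^sup>2 * cmod (B - 2 * A\<^sup>2)) \<le> (\<kappa> + 2) * max \<bar>6 - \<kappa>\<bar> \<kappa>"
    by (rule mult_mono[OF B B2]) (use \<kappa> in auto)
  then have prod: "cmod B * cmod (B - 2 * A\<^sup>2) \<le> (\<kappa> + 2) * max \<bar>6 - \<kappa>\<bar> \<kappa> / \<kappa> ^ 4"
    using \<kappa> by (simp add: pos_le_divide_eq algebra_simps power4_eq_xxxx power2_eq_square)
  have A: "2 * (cmod A)\<^sup>2 \<le> 8 / \<kappa>\<^sup>2"
    using t(2) \<kappa> by (simp add: t_def pos_le_divide_eq algebra_simps)
  have "1 - B\<^sup>2 - 2 * A\<^sup>2 + 2 * A\<^sup>2 * B = 1 - 2 * A\<^sup>2 - B * (B - 2 * A\<^sup>2)"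
    by (simp add: algebra_simps power2_eq_square)
  then have "cmod (1 - B\<^sup>2 - 2 * A\<^sup>2 + 2 * A\<^sup>2 * B) \<le> cmod (1 - 2 * A\<^sup>2) + cmod (B * (B - 2 * A\<^sup>2))"
    by (metis norm_triangle_ineq4)
  also have "cmod (1 - 2 * A\<^sup>2) \<le> 1 + 2 * (cmod A)\<^sup>2"
    using norm_triangle_ineq4[of 1 "2 * A\<^sup>2"] by (simp add: norm_mult norm_power)
  finally show ?thesis
    using A prod by (simp add: norm_mult)
qed

section \<open>The extremal function\<close>

text \<open>The factor \<open>\<i>\<close> makes the square of the coefficient at
  \<open>k + 1\<close> negative, so that for \<open>k\<close> at most 3 the terms \<open>1\<close>,
  \<open>- 2 * A^2\<close> and \<open>- B * (B - 2 * A^2)\<close> are all positive and no triangle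
  inequality loses anything. On the disk the base of \<open>powr\<close> has positive real part, so
  the principal branch is holomorphic.\<close>

definition rotated_koebe_root :: "nat \<Rightarrow> complex \<Rightarrow> complex" where
  "rotated_koebe_root k z = z * (1 - \<i> * z ^ k) powr (- (2 / of_nat k))"

lemma Re_one_minus_i_power_pos:
  assumes "k \<ge> 1" "cmod z < 1"
  shows "0 < Re (1 - \<i> * z ^ k)" "cmod (z ^ k) < 1"
proof -
  show *: "cmod (z ^ k) < 1"
    using assms by (simp add: norm_power power_less_one_iff)
  with * show "0 < Re (1 - \<i> * z ^ k)"
    using abs_Im_le_cmod[of "z ^ k"] by simp
qed

text \<open>The hypothesis is the cross-multiplied equality of \<open>u / (1 - \<i> * u)^2\<close>
  at two points. The difference of its sides factors as \<open>(u - v) * (1 + u * v)\<close>, and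
  the second factor cannot vanish in the disk.\<close>

lemma koebe_inj:
  fixes u v :: complex
  assumes "cmod u < 1" "cmod v < 1" and eq: "u * (1 - \<i> * v)\<^sup>2 = v * (1 - \<i> * u)\<^sup>2"
  shows "u = v"
proof -
  have "(u - v) * (1 + u * v) = u * (1 - \<i> * v)\<^sup>2 - v * (1 - \<i> * u)\<^sup>2"
    by (simp add: power2_eq_square algebra_simps)
  then have "(u - v) * (1 + u * v) = 0"
    using eq by simp
  moreover have "cmod (u * v) < 1"
    using mult_strict_mono'[of "cmod u" 1 "cmod v" 1] assms by (simp add: norm_mult)
  then have "1 + u * v \<noteq> 0"
    by (metis add.commute eq_neg_iff_add_eq_0 norm_minus_cancel norm_one less_irrefl)
  ultimately show ?thesis
    by simp
qed

lemma rotated_koebe_root_in_class_S_star: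
  assumes k: "k \<ge> 1"
  shows "rotated_koebe_root k \<in> class_S_star"
proof -
  let ?f = "rotated_koebe_root k"
  let ?e = "- (2 / of_nat k) :: complex"
  note pos = Re_one_minus_i_power_pos[OF k]
  have nonpos: "1 - \<i> * z ^ k \<notin> \<real>\<^sub>\<le>\<^sub>0" if "cmod z < 1" for z
    using pos(1)[OF that] by (auto simp: complex_nonpos_Reals_iff simp del: minus_complex.sel)
  have nz: "1 - \<i> * z ^ k \<noteq> 0" if "cmod z < 1" for z
    using nonpos[OF that] by auto
  have df: "(?f has_field_derivative
      (1 - \<i> * z ^ k) powr ?e * ((1 + \<i> * z ^ k) / (1 - \<i> * z ^ k))) (at z)" if "cmod z < 1" for z
  proof -
    have "((\<lambda>z. (1 - \<i> * z ^ k) powr ?e) has_field_derivative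
        ?e * (1 - \<i> * z ^ k) powr (?e - 1) * (- (\<i> * (of_nat k * z ^ (k - 1))))) (at z)"
      using nonpos[OF that] by (auto intro!: derivative_eq_intros)
    then have "(?f has_field_derivative (1 - \<i> * z ^ k) powr ?e +
        z * (?e * (1 - \<i> * z ^ k) powr (?e - 1) * (- (\<i> * (of_nat k * z ^ (k - 1)))))) (at z)"
      unfolding rotated_koebe_root_def[abs_def]
      by (rule DERIV_cong[OF DERIV_mult[OF DERIV_ident]]) simp
    also have "z * (?e * (1 - \<i> * z ^ k) powr (?e - 1) * (- (\<i> * (of_nat k * z ^ (k - 1)))))
        = (of_nat k * (2 / of_nat k)) * \<i> * (z * z ^ (k - 1)) * (1 - \<i> * z ^ k) powr (?e - 1)"
      by (simp only: mult_ac minus_mult_minus mult_minus_left mult_minus_right minus_minus)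
    also have "of_nat k * (2 / of_nat k) = (2 :: complex)"
      using k by simp
    also have "z * z ^ (k - 1) = z ^ k"
      using k by (cases k) auto
    also have "(1 - \<i> * z ^ k) powr (?e - 1) = (1 - \<i> * z ^ k) powr ?e / (1 - \<i> * z ^ k)"
      using nz[OF that] by (simp add: powr_diff)
    also have "(1 - \<i> * z ^ k) powr ?e + 2 * \<i> * z ^ k * ((1 - \<i> * z ^ k) powr ?e / (1 - \<i> * z ^ k))
        = (1 - \<i> * z ^ k) powr ?e * ((1 + \<i> * z ^ k) / (1 - \<i> * z ^ k))"
      using nz[OF that] by (simp add: field_simps)
    finally show ?thesis .
  qed
  have "?f holomorphic_on ball 0 1"
    by (rule holomorphic_onI)
       (use df in \<open>auto simp: field_differentiable_def intro: has_field_derivative_at_within\<close>)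
  moreover have "?f 0 = 0"
    by (simp add: rotated_koebe_root_def)
  moreover have "deriv ?f 0 = 1"
    using DERIV_imp_deriv[OF df[of 0]] k by (simp add: power_0_left)
  moreover have "inj_on ?f (ball 0 1)"
  proof (rule inj_onI)
    fix z w assume "z \<in> ball 0 1" "w \<in> ball 0 1" and eq: "?f z = ?f w"
    then have z: "cmod z < 1" and w: "cmod w < 1"
      by auto
    \<comment> \<open>The \<open>k\<close>-th power turns the exponent \<open>- 2 / k\<close> into
      \<open>- 2\<close>, so equal values of the root give equal Koebe values at
      \<open>z ^ k\<close> and \<open>w ^ k\<close>.\<close>
    have fk: "?f z ^ k = z ^ k / (1 - \<i> * z ^ k)\<^sup>2" if "cmod z < 1" for z
    proof -
      have "((1 - \<i> * z ^ k) powr ?e) ^ k = (1 - \<i> * z ^ k) powr (of_nat k * ?e)"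
        using nz[OF that] by (simp add: powr_def flip: exp_of_nat_mult)
      also have "of_nat k * ?e = - of_nat 2"
        using k by simp
      also have "(1 - \<i> * z ^ k) powr (- of_nat 2) = inverse ((1 - \<i> * z ^ k)\<^sup>2)"
        using nz[OF that] by (simp add: powr_minus powr_nat)
      finally show ?thesis
        by (simp add: rotated_koebe_root_def power_mult_distrib divide_inverse)
    qed
    have "z ^ k / (1 - \<i> * z ^ k)\<^sup>2 = w ^ k / (1 - \<i> * w ^ k)\<^sup>2"
      using eq fk[OF z] fk[OF w] by simp
    then have "z ^ k * (1 - \<i> * w ^ k)\<^sup>2 = w ^ k * (1 - \<i> * z ^ k)\<^sup>2"
      using nz[OF z] nz[OF w] by (simp add: frac_eq_eq)
    then have "z ^ k = w ^ k"
      using koebe_inj pos(2) z w by blast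
    \<comment> \<open>Since \<open>z ^ k = w ^ k\<close>, the \<open>powr\<close> factors of both
      values coincide; they are nonzero and cancel.\<close>
    with eq nz[OF w] show "z = w"
      by (simp add: rotated_koebe_root_def)
  qed
  moreover have "0 < Re (z * deriv ?f z / ?f z)" if z: "cmod z < 1" "z \<noteq> 0" for z
  proof -
    define u where "u = \<i> * z ^ k"
    have u: "cmod u < 1"
      using pos(2)[OF z(1)] by (simp add: u_def norm_mult)
    have "z * deriv ?f z / ?f z = (1 + u) / (1 - u)"
      using DERIV_imp_deriv[OF df[OF z(1)]] nz[OF z(1)] z(2)
      by (simp add: rotated_koebe_root_def u_def)
    \<comment> \<open>Expanding by the conjugate of the denominator shows the real part to be
      \<open>(1 - |u|^2) / |1 - u|^2\<close>.\<close>
    also have "\<dots> = (1 + u) * cnj (1 - u) / of_real ((cmod (1 - u))\<^sup>2)"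
      by (metis complex_div_cnj of_real_power)
    also have "Re \<dots> = Re ((1 + u) * cnj (1 - u)) / (cmod (1 - u))\<^sup>2"
      by (rule Re_divide_of_real)
    also have "Re ((1 + u) * cnj (1 - u)) = 1 - (cmod u)\<^sup>2"
      unfolding cmod_power2 by (simp add: power2_eq_square algebra_simps)
    finally show ?thesis
      using u nz[OF z(1)] by (simp add: u_def[symmetric] abs_square_less_1)
  qed
  ultimately show ?thesis
    by (auto simp: class_S_star_def class_S_def)
qed

text \<open>This is the binomial series in \<open>- \<i> * z ^ k\<close>, multiplied by
  \<open>z\<close>. The quotient \<open>(m - 1) div k\<close> recovers \<open>n\<close> from the
  index \<open>m = n * k + 1\<close>.\<close>

lemma rotated_koebe_root_gap_expansion:
  assumes k: "k \<ge> 1"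
  shows "has_gap_expansion k (rotated_koebe_root k)
    (\<lambda>m. (- (2 / of_nat k) gchoose ((m - 1) div k)) * (- \<i>) ^ ((m - 1) div k))"
  unfolding has_gap_expansion_def
proof
  fix z :: complex assume "z \<in> ball 0 1"
  then have z: "cmod z < 1"
    by simp
  let ?e = "- (2 / of_nat k) :: complex"
  let ?c = "\<lambda>n. z * ((?e gchoose n) * (- \<i> * z ^ k) ^ n)"
  have "cmod (- \<i> * z ^ k) < 1"
    using Re_one_minus_i_power_pos(2)[OF k z] by (simp add: norm_mult)
  from sums_mult[OF gen_binomial_complex[OF this], of z ?e]
  have "?c sums rotated_koebe_root k z"
    by (simp add: rotated_koebe_root_def)
  then have "(\<lambda>n. ?c (Suc n)) sums (rotated_koebe_root k z - z)"
    by (subst sums_Suc_iff) simp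
  moreover have "?c n = (?e gchoose n) * (- \<i>) ^ n * z ^ (n * k + 1)" for n
    by (simp only: power_mult_distrib power_mult[symmetric]) (simp add: mult_ac)
  moreover have "(Suc n * k + 1 - 1) div k = Suc n" for n
    using k by (simp only: add_diff_cancel_right' nonzero_mult_div_cancel_right)
  ultimately show "(\<lambda>n. (?e gchoose ((Suc n * k + 1 - 1) div k)) *
      (- \<i>) ^ ((Suc n * k + 1 - 1) div k) * z ^ (Suc n * k + 1)) sums (rotated_koebe_root k z - z)"
    by (simp only:)
qed

section \<open>The estimate and its sharpness\<close>

theorem theorem5:
  shows "(\<forall>(k::nat) (f::complex \<Rightarrow> complex) (a::nat \<Rightarrow> complex).
            k \<ge> 1 \<longrightarrow> f \<in> class_S_star \<longrightarrow> has_gap_expansion k f a \<longrightarrow>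
              (1 \<le> k \<and> k \<le> 3 \<longrightarrow>
                 cmod (1 - (a (2*k+1))^2 - 2 * (a (k+1))^2 + 2 * (a (k+1))^2 * a (2*k+1))
                   \<le> 1 + 8 / real k ^ 2 + (real k + 2) * (6 - real k) / real k ^ 4) \<and>
              (k \<ge> 3 \<longrightarrow>
                 cmod (1 - (a (2*k+1))^2 - 2 * (a (k+1))^2 + 2 * (a (k+1))^2 * a (2*k+1))
                   \<le> 1 + 8 / real k ^ 2 + (2 + real k) / real k ^ 3))
       \<and> (\<forall>k \<in> {1, 2, 3::nat}. \<exists>f \<in> class_S_star. \<exists>a::nat \<Rightarrow> complex.
            has_gap_expansion k f a \<and>
            cmod (1 - (a (2*k+1))^2 - 2 * (a (k+1))^2 + 2 * (a (k+1))^2 * a (2*k+1))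
              = 1 + 8 / real k ^ 2 + (real k + 2) * (6 - real k) / real k ^ 4)"
proof (intro conjI allI impI ballI)
  fix k :: nat and f :: "complex \<Rightarrow> complex" and a :: "nat \<Rightarrow> complex"
  assume k: "k \<ge> 1" and f: "f \<in> class_S_star" and gap: "has_gap_expansion k f a"
  have bd: "cmod (1 - (a (2*k+1))\<^sup>2 - 2 * (a (k+1))\<^sup>2 + 2 * (a (k+1))\<^sup>2 * a (2*k+1))
      \<le> 1 + 8 / (real k)\<^sup>2 + (real k + 2) * max \<bar>6 - real k\<bar> (real k) / real k ^ 4"
    by (rule det_bound_of_coeff_bound)
       (use k starlike_gap_coeff_bound[OF k f gap] in simp_all)
  {
    assume "1 \<le> k \<and> k \<le> 3"
    \<comment> \<open>The two terms of the maximum are equal at \<open>k = 3\<close>, which is where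
      the two cases of the estimate meet.\<close>
    then have "max \<bar>6 - real k\<bar> (real k) = 6 - real k"
      by simp
    with bd show "cmod (1 - (a (2*k+1))^2 - 2 * (a (k+1))^2 + 2 * (a (k+1))^2 * a (2*k+1))
        \<le> 1 + 8 / real k ^ 2 + (real k + 2) * (6 - real k) / real k ^ 4"
      by simp
  }
  {
    assume "k \<ge> 3"
    then have "max \<bar>6 - real k\<bar> (real k) = real k"
      by simp
    moreover have "(real k + 2) * real k / real k ^ 4 = (2 + real k) / real k ^ 3"
      using k by (simp add: power_numeral_reduce)
    ultimately show "cmod (1 - (a (2*k+1))^2 - 2 * (a (k+1))^2 + 2 * (a (k+1))^2 * a (2*k+1))
        \<le> 1 + 8 / real k ^ 2 + (2 + real k) / real k ^ 3"
      using bd by simp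
  }
next
  fix k :: nat
  assume k: "k \<in> {1, 2, 3}"
  then have k1: "k \<ge> 1"
    by auto
  define a :: "nat \<Rightarrow> complex" where
    "a m = (- (2 / of_nat k) gchoose ((m - 1) div k)) * (- \<i>) ^ ((m - 1) div k)" for m
  have A: "a (k + 1) = 2 * \<i> / of_nat k"
    using k1 by (simp add: a_def)
  have B: "a (2 * k + 1) = - ((of_nat k + 2) / (of_nat k)\<^sup>2)"
    using k1 by (simp add: a_def gbinomial_Suc numeral_2_eq_2 field_simps)
  \<comment> \<open>The expression is a nonnegative real for these \<open>k\<close>, hence equal to
    its modulus.\<close>
  have "1 - (a (2*k+1))^2 - 2 * (a (k+1))^2 + 2 * (a (k+1))^2 * a (2*k+1)
      = of_real (1 + 8 / real k ^ 2 + (real k + 2) * (6 - real k) / real k ^ 4)"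
    unfolding A B using k by (auto simp: power_divide power_mult_distrib)
  moreover have "0 \<le> 1 + 8 / real k ^ 2 + (real k + 2) * (6 - real k) / real k ^ 4"
    using k by auto
  ultimately have eq: "cmod (1 - (a (2*k+1))^2 - 2 * (a (k+1))^2 + 2 * (a (k+1))^2 * a (2*k+1))
      = 1 + 8 / real k ^ 2 + (real k + 2) * (6 - real k) / real k ^ 4"
    by (metis abs_of_nonneg norm_of_real)
  have gap: "has_gap_expansion k (rotated_koebe_root k) a"
    unfolding a_def[abs_def] by (rule rotated_koebe_root_gap_expansion[OF k1])
  show "\<exists>f \<in> class_S_star. \<exists>a::nat \<Rightarrow> complex.
      has_gap_expansion k f a \<and>
      cmod (1 - (a (2*k+1))^2 - 2 * (a (k+1))^2 + 2 * (a (k+1))^2 * a (2*k+1))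
        = 1 + 8 / real k ^ 2 + (real k + 2) * (6 - real k) / real k ^ 4"
    by (intro bexI[of _ "rotated_koebe_root k"] exI[of _ a] conjI gap eq
        rotated_koebe_root_in_class_S_star[OF k1])
qed

end
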